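(* Assume (A1) the vectors $Y_1,Y_2,\dots$ are i.i.d. in $\mathbb{R}^K$ and $Y_i$ is independent of $\mathcal{F}_{i-1}$; (A2) $\mathbb{E}[Y_1]=0$; (A3) $\mathbb{E}[\max_{1\le k\le K}|Y_{1,k}|]<\infty$; and assume that $\sigma_k^2=\mathrm{Var}(Y_{1,k})<\infty$ for each $k$. Let $\Sigma=\mathrm{Cov}(Y_1)$ and $c=\mathbb{E}[\max_{1\le k\le K}Z_k]$, where $Z=(Z_1,\dots,Z_K)\sim N(\mathbf{0},\Sigma)$. Then: (a) (Square-root growth.) $\mathbb{E}[M_n]=c\sqrt n+o(\sqrt n)$. (b) (Bias concentration.) For any $0<\alpha<1$, $$\frac{\sum_{i=1}^{\lfloor\alpha n\rfloor}\mathbb{E}[\varphi_K(S_{i-1})]}{\mathbb{E}[M_n]}\to\sqrt\alpha\quad\text{as } n\to\infty.$$ That is, the first $\alpha$-fraction of steps generates a $\sqrt\alpha$-fraction of total bias.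
   Context: Fix an integer $K\ge 1$ and a probability space $(\Omega,\mathcal{F},P)$. Let $X_1,X_2,\dots$ be i.i.d. random elements of a measurable space $\mathcal{X}$ (with generic copy $X$), and for $k\in\{1,\dots,K\}$ let $f_k:\mathcal{X}\to\mathbb{R}$ be measurable with mean $\mu_k=\mathbb{E}[f_k(X)]$. Put $Y_{i,k}=f_k(X_i)-\mu_k$ and $Y_i=(Y_{i,1},\dots,Y_{i,K})\in\mathbb{R}^K$ (the coordinates of $Y_i$ may be dependent). Let $S_{n,k}=\sum_{i=1}^n Y_{i,k}$, $S_n=(S_{n,1},\dots,S_{n,K})$, $S_0=(0,\dots,0)\in\mathbb{R}^K$, and $M_n=\max_{1\le k\le K}S_{n,k}$; the "total bias" is $\mathbb{E}[M_n]$. The filtration is $\mathcal{F}_n=\sigma(X_1,\dots,X_n)$, with $\mathcal{F}_0=\{\emptyset,\Omega\}$. The selection premium function $\varphi_K:\mathbb{R}^K\to\mathbb{R}$ is $$\varphi_K(u)=\mathbb{E}\Bigl[\max_{1\le k\le K}(u_k+Y_k)\Bigr]-\max_{1\le k\le K}u_k,$$ where $Y=(Y_1,\dots,Y_K)$ inside this formula denotes a random vector with the same distribution as the increment vector $(Y_{1,1},\dots,Y_{1,K})$.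
   Formalization: Part (b) is stated under the proviso that E[M_n] is nonzero for all large n; otherwise (for example K = 1, or all coordinates of Y_1 almost surely equal) E[M_n] = 0 for every n and the quotient is undefined. *)

theory Defs
  imports "HOL-Probability.Probability" "HOL-Library.Landau_Symbols"
begin

text \<open>
  The \<open>K \<ge> 1\<close> candidates are indexed by a finite type \<open>'k\<close>, so that \<open>\<real>\<^sup>K\<close> is \<^typ>\<open>real ^ 'k\<close>
  and \<open>K = CARD('k)\<close>. The sample \<open>X i\<close> is indexed by \<open>i \<ge> 1\<close>; \<open>X 0\<close> is never used.
\<close>

definition vmax :: "real ^ 'k \<Rightarrow> real" where
  "vmax u = (MAX k. u $ k)"

definition centred_score ::
  "'a measure \<Rightarrow> (nat \<Rightarrow> 'a \<Rightarrow> 'x) \<Rightarrow> ('k::finite \<Rightarrow> 'x \<Rightarrow> real) \<Rightarrow> nat \<Rightarrow> 'a \<Rightarrow> real ^ 'k" where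
  "centred_score P X f i \<omega> = (\<chi> k. f k (X i \<omega>) - (\<integral>\<omega>'. f k (X 1 \<omega>') \<partial>P))"

definition partial_sum :: "(nat \<Rightarrow> 'a \<Rightarrow> real ^ 'k) \<Rightarrow> nat \<Rightarrow> 'a \<Rightarrow> real ^ 'k" where
  "partial_sum Y n \<omega> = (\<Sum>i=1..n. Y i \<omega>)"

definition total_bias :: "'a measure \<Rightarrow> (nat \<Rightarrow> 'a \<Rightarrow> real ^ 'k) \<Rightarrow> nat \<Rightarrow> real" where
  "total_bias P Y n = (\<integral>\<omega>. vmax (partial_sum Y n \<omega>) \<partial>P)"

definition past_events ::
  "'a measure \<Rightarrow> 'x measure \<Rightarrow> (nat \<Rightarrow> 'a \<Rightarrow> 'x) \<Rightarrow> nat \<Rightarrow> 'a set set" where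
  "past_events P MX X n =
     sigma_sets (space P) {X i -` A \<inter> space P | i A. i \<in> {1..n} \<and> A \<in> sets MX}"

text \<open>The argument \<open>D\<close> is the common law of the increment vectors.\<close>

definition selection_premium :: "(real ^ 'k) measure \<Rightarrow> real ^ 'k \<Rightarrow> real" where
  "selection_premium D u = (\<integral>y. vmax (u + y) \<partial>D) - vmax u"

definition covariance_matrix :: "'a measure \<Rightarrow> ('a \<Rightarrow> real ^ 'k) \<Rightarrow> real ^ 'k ^ 'k" where
  "covariance_matrix P V =
     (\<chi> i j. \<integral>\<omega>. (V \<omega> $ i - (\<integral>\<omega>'. V \<omega>' $ i \<partial>P)) * (V \<omega> $ j - (\<integral>\<omega>'. V \<omega>' $ j \<partial>P)) \<partial>P)"

text \<open>
  \<open>N(m, v)\<close> with mean \<open>m\<close> and variance \<open>v \<ge> 0\<close>. It is written as an affine image of the standard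
  normal law so that \<open>v = 0\<close> gives the point mass at \<open>m\<close>.
\<close>

definition normal_law :: "real \<Rightarrow> real \<Rightarrow> real measure" where
  "normal_law m v = distr std_normal_distribution borel (\<lambda>x. m + sqrt v * x)"

text \<open>
  \<open>Z \<sim> N(m, C)\<close> in the sense that every linear combination \<open>t \<bullet> Z\<close> is normal with mean \<open>t \<bullet> m\<close> and
  variance \<open>t\<^sup>T C t\<close>. This allows a singular \<open>C\<close>.
\<close>

definition multivariate_normal ::
  "'b measure \<Rightarrow> ('b \<Rightarrow> real ^ 'k) \<Rightarrow> real ^ 'k \<Rightarrow> real ^ 'k ^ 'k \<Rightarrow> bool" where
  "multivariate_normal N Z m C \<longleftrightarrow>
     Z \<in> borel_measurable N \<and>
     (\<forall>t. distr N borel (\<lambda>\<omega>. t \<bullet> Z \<omega>) = normal_law (t \<bullet> m) (t \<bullet> (C *v t)))"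

end

theory Submission
  imports Defs "HOL-Real_Asymp.Real_Asymp"
begin

text \<open>
  The multivariate central limit theorem is needed only for the test function \<open>vmax\<close>, so no
  uniqueness or tightness theory in \<open>\<real>\<^sup>K\<close> is required. The map \<open>x \<mapsto> vmax (L sin (x\<^sub>k / L))\<^sub>k\<close> differs from
  \<open>vmax\<close> by at most \<open>\<bar>x\<bar>\<^sup>2 / (2 L)\<close>, and since its argument stays in a ball, the Weierstrass theorem
  makes it uniformly close to a polynomial in the \<open>sin (x\<^sub>k / L)\<close>, that is, to a linear combination of
  the functions \<open>cos (t \<bullet> x)\<close> and \<open>sin (t \<bullet> x)\<close>. Expectations of the latter under \<open>S\<^sub>n / \<surd>n\<close> converge by
  the one-dimensional central limit theorem for \<open>t \<bullet> Y\<^sub>i\<close>, while bounded second moments make the error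
  of order \<open>1 / L\<close> uniformly in \<open>n\<close>. Hence \<open>E[M\<^sub>n] / \<surd>n\<close> tends to \<open>c\<close>.
  By Fubini the selection premiums telescope, so the numerator in (b) is the total bias at
  \<open>\<lfloor>\<alpha>n\<rfloor>\<close>, and the ratio of the two square-root laws is \<open>\<surd>\<alpha>\<close> unless \<open>c = 0\<close>, in which case the total bias is
  identically zero.
\<close>

subsection \<open>Trigonometric approximation of the maximum\<close>

lemma component_le_vmax: "u $ k \<le> vmax u"
  unfolding vmax_def by (rule Max_ge) auto

lemma vmax_le_iff: "vmax u \<le> a \<longleftrightarrow> (\<forall>k. u $ k \<le> a)"
  unfolding vmax_def by (subst Max_le_iff) auto

lemma vmax_diff_le:
  assumes "\<And>k. \<bar>u $ k - v $ k\<bar> \<le> d"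
  shows "\<bar>vmax u - vmax v\<bar> \<le> d"
proof -
  have "vmax x \<le> vmax y + d" if "\<And>k. \<bar>x $ k - y $ k\<bar> \<le> d" for x y :: "real ^ 'a"
  proof -
    have "x $ k \<le> vmax y + d" for k
      using that[of k] component_le_vmax[of y k] by linarith
    then show ?thesis by (simp add: vmax_le_iff)
  qed
  from this[of u v] this[of v u] assms show ?thesis
    by (smt (verit))
qed

lemma vmax_lipschitz: "\<bar>vmax u - vmax v\<bar> \<le> norm (u - v)"
  by (rule vmax_diff_le) (metis component_le_norm_cart vector_minus_component)

lemma vmax_zero [simp]: "vmax 0 = 0"
  by (simp add: vmax_def)

lemma abs_vmax_le_norm: "\<bar>vmax u\<bar> \<le> norm u"
  using vmax_lipschitz[of u 0] by simp

lemma vmax_scaleR: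
  assumes "0 \<le> a"
  shows "vmax (a *\<^sub>R u) = a * vmax u"
proof (cases "a = 0")
  case False
  with assms have "0 < a" by simp
  \<comment> \<open>Two reals with the same upper bounds \<open>b\<close> are equal, so only the
    bounds are compared.\<close>
  then have "vmax (a *\<^sub>R u) \<le> b \<longleftrightarrow> a * vmax u \<le> b" for b
    using vmax_le_iff[of u "b / a"] by (simp add: vmax_le_iff[of "a *\<^sub>R u"] field_simps)
  then show ?thesis by (meson order_antisym order_refl)
qed simp

lemma continuous_on_vmax: "continuous_on S vmax"
proof (rule continuous_on_subset[OF _ subset_UNIV])
  show "continuous_on UNIV (vmax :: real ^ 'a \<Rightarrow> real)"
    unfolding continuous_on_iff
    by (metis dist_norm real_norm_def vmax_lipschitz le_less_trans)
qed

lemma borel_measurable_vmax [measurable]: "vmax \<in> borel_measurable borel"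
  by (rule borel_measurable_continuous_onI[OF continuous_on_vmax])

lemma borel_measurable_vec_component [measurable]:
  "(\<lambda>u :: real ^ 'k. u $ k) \<in> borel_measurable borel"
  by (rule borel_measurable_continuous_onI) (intro continuous_intros)

lemma borel_measurable_inner_const [measurable]:
  "(\<lambda>u :: real ^ 'k. t \<bullet> u) \<in> borel_measurable borel"
  by (rule borel_measurable_continuous_onI) (intro continuous_intros)

text \<open>The real span of the functions \<open>cos (t \<bullet> x)\<close> and
  \<open>sin (t \<bullet> x)\<close>, whose expectations are the real and imaginary parts of
  characteristic functions. Closure under products is not built in, so an induction over
  \<open>trig_poly\<close> only has to treat linear operations.\<close>

inductive trig_poly :: "('a::real_inner \<Rightarrow> real) \<Rightarrow> bool" where
  cos: "trig_poly (\<lambda>x. cos (t \<bullet> x))"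
| sin: "trig_poly (\<lambda>x. sin (t \<bullet> x))"
| add: "trig_poly f \<Longrightarrow> trig_poly g \<Longrightarrow> trig_poly (\<lambda>x. f x + g x)"
| scale: "trig_poly f \<Longrightarrow> trig_poly (\<lambda>x. a * f x)"

lemma trig_poly_const: "trig_poly (\<lambda>x. a)"
  using trig_poly.scale[OF trig_poly.cos[of 0], of a] by simp

lemma trig_poly_diff:
  assumes "trig_poly f" "trig_poly g"
  shows "trig_poly (\<lambda>x. f x - g x)"
  using trig_poly.add[OF assms(1) trig_poly.scale[OF assms(2), of "-1"]] by simp

lemma trig_poly_sum:
  "finite A \<Longrightarrow> (\<And>i. i \<in> A \<Longrightarrow> trig_poly (f i)) \<Longrightarrow> trig_poly (\<lambda>x. \<Sum>i\<in>A. f i x)"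
  by (induction A rule: finite_induct) (auto intro: trig_poly.add trig_poly_const)

text \<open>The product-to-sum formulas turn a product of generators with frequencies
  \<open>s\<close> and \<open>t\<close> into a combination of generators with frequencies
  \<open>s + t\<close> and \<open>s - t\<close>. Bilinearity does the rest: the outer induction runs
  over the first factor, the inner one over the second.\<close>

lemma trig_poly_mult:
  assumes "trig_poly f" "trig_poly g"
  shows "trig_poly (\<lambda>x. f x * g x)"
  using assms(1)
proof (induction rule: trig_poly.induct)
  case (cos s)
  from assms(2) show ?case
  proof (induction rule: trig_poly.induct)
    case (cos t)
    have "trig_poly (\<lambda>x. 1/2 * (cos ((s - t) \<bullet> x) + cos ((s + t) \<bullet> x)))"
      by (intro trig_poly.intros)
    then show ?case by (simp add: cos_times_cos inner_left_distrib inner_diff_left)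
  next
    case (sin t)
    have "trig_poly (\<lambda>x. 1/2 * (sin ((s + t) \<bullet> x) - sin ((s - t) \<bullet> x)))"
      by (intro trig_poly.intros trig_poly_diff)
    then show ?case by (simp add: cos_times_sin inner_left_distrib inner_diff_left)
  qed (simp_all add: distrib_left mult.left_commute trig_poly.add trig_poly.scale)
next
  case (sin s)
  from assms(2) show ?case
  proof (induction rule: trig_poly.induct)
    case (cos t)
    have "trig_poly (\<lambda>x. 1/2 * (sin ((s + t) \<bullet> x) + sin ((s - t) \<bullet> x)))"
      by (intro trig_poly.intros)
    then show ?case by (simp add: sin_times_cos inner_left_distrib inner_diff_left)
  next
    case (sin t)
    have "trig_poly (\<lambda>x. 1/2 * (cos ((s - t) \<bullet> x) - cos ((s + t) \<bullet> x)))"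
      by (intro trig_poly.intros trig_poly_diff)
    then show ?case by (simp add: sin_times_sin inner_left_distrib inner_diff_left)
  qed (simp_all add: distrib_left mult.left_commute trig_poly.add trig_poly.scale)
qed (simp_all add: distrib_right mult.assoc trig_poly.add trig_poly.scale)

text \<open>For linear \<open>h\<close>, expansion in the standard basis leaves the terms
  \<open>sin (x $ k / L)\<close>, which are generators with frequency \<open>axis k (1 / L)\<close>.
  Sums and products follow from the closure properties.\<close>

lemma trig_poly_real_polynomial_sin:
  fixes q :: "real ^ 'k \<Rightarrow> real"
  assumes "real_polynomial_function q"
  shows "trig_poly (\<lambda>x :: real ^ 'k. q (\<chi> k. L * sin (x $ k / L)))"
  using assms
proof (induction rule: real_polynomial_function.induct)
  case (linear h)
  then interpret bounded_linear h .
  have eq: "h (\<chi> k. L * sin (x $ k / L)) = (\<Sum>k\<in>UNIV. (L * h (axis k 1)) * sin (axis k (1 / L) \<bullet> x))"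
    for x :: "real ^ 'k"
  proof -
    have "h (\<chi> k. L * sin (x $ k / L)) = h (\<Sum>k\<in>UNIV. (L * sin (x $ k / L)) *\<^sub>R axis k 1)"
      by (rule arg_cong[where f = h])
        (simp add: vec_eq_iff axis_def if_distrib sum.delta cong: if_cong)
    then show ?thesis by (simp add: sum scaleR inner_axis' mult_ac)
  qed
  show ?case
    unfolding eq by (intro trig_poly_sum trig_poly.intros) simp
qed (auto intro: trig_poly_const trig_poly.add trig_poly_mult)

text \<open>Taylor remainder of order two. The quadratic bound is preferred to the cubic one because
  only second moments are controlled later.\<close>

lemma abs_sin_minus_self_le: "\<bar>sin x - x\<bar> \<le> x\<^sup>2 / 2" for x :: real
  using Maclaurin_sin_bound[of x 2]
  by (simp add: sin_coeff_def numeral_2_eq_2 field_simps)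

lemma vmax_sin_approx:
  fixes x :: "real ^ 'k"
  assumes "0 < L"
  shows "\<bar>vmax x - vmax (\<chi> k. L * sin (x $ k / L))\<bar> \<le> (norm x)\<^sup>2 / (2 * L)"
proof (rule vmax_diff_le)
  fix k
  have "x $ k - L * sin (x $ k / L) = - L * (sin (x $ k / L) - x $ k / L)"
    using assms by (simp add: right_diff_distrib)
  then have "\<bar>x $ k - L * sin (x $ k / L)\<bar> = L * \<bar>sin (x $ k / L) - x $ k / L\<bar>"
    using assms by (simp only: abs_mult abs_minus_cancel abs_of_pos)
  also have "\<dots> \<le> L * ((x $ k / L)\<^sup>2 / 2)"
    using assms abs_sin_minus_self_le by (intro mult_left_mono) auto
  also have "\<dots> = (x $ k)\<^sup>2 / (2 * L)"
    using assms by (simp add: power2_eq_square)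
  also have "\<dots> \<le> (norm x)\<^sup>2 / (2 * L)"
    using assms component_le_norm_cart[of x k]
    by (intro divide_right_mono) (auto simp: abs_le_square_iff[symmetric])
  finally show "\<bar>x $ k - (\<chi> k. L * sin (x $ k / L)) $ k\<bar> \<le> (norm x)\<^sup>2 / (2 * L)"
    by simp
qed

lemma vmax_trig_poly_approx:
  assumes "0 < L" "0 < e"
  obtains p :: "real ^ 'k \<Rightarrow> real"
    where "trig_poly p" "\<And>x. \<bar>vmax x - p x\<bar> \<le> (norm x)\<^sup>2 / (2 * L) + e"
proof -
  \<comment> \<open>The Euclidean norm is at most the sum of the absolute coordinates, and each of
    the \<open>CARD('k)\<close> coordinates \<open>L * sin (x $ k / L)\<close> is at most
    \<open>L\<close> in size.\<close>
  let ?R = "real CARD('k) * L"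
  obtain q :: "real ^ 'k \<Rightarrow> real" where q: "real_polynomial_function q"
    and qe: "\<And>x. x \<in> cball 0 ?R \<Longrightarrow> \<bar>vmax x - q x\<bar> < e"
    using Stone_Weierstrass_real_polynomial_function[OF compact_cball continuous_on_vmax assms(2)]
    by blast
  have "\<bar>vmax x - q (\<chi> k. L * sin (x $ k / L))\<bar> \<le> (norm x)\<^sup>2 / (2 * L) + e" for x :: "real ^ 'k"
  proof -
    let ?y = "(\<chi> k. L * sin (x $ k / L)) :: real ^ 'k"
    have "norm ?y \<le> (\<Sum>k\<in>UNIV. \<bar>?y $ k\<bar>)"
      by (rule norm_le_l1_cart)
    also have "\<dots> \<le> (\<Sum>k\<in>(UNIV :: 'k set). L)"
      using assms by (intro sum_mono) (simp add: abs_mult mult_le_cancel_left1)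
    finally have "?y \<in> cball 0 ?R" by simp
    from qe[OF this] vmax_sin_approx[OF assms(1), of x] show ?thesis by linarith
  qed
  with trig_poly_real_polynomial_sin[OF q] that show thesis by blast
qed

subsection \<open>Convergence of expectations\<close>

text \<open>Linearity extends the convergence from the generators to their span. Integrability is
  part of the induction claim because additivity of the integral relies on it.\<close>

lemma expectation_trig_poly_tendsto:
  fixes W :: "nat \<Rightarrow> 'a \<Rightarrow> real ^ 'k" and Z :: "'b \<Rightarrow> real ^ 'k"
  assumes "prob_space M" "prob_space N"
    and W [measurable]: "\<And>n. W n \<in> borel_measurable M" and Z [measurable]: "Z \<in> borel_measurable N"
    and cos: "\<And>t. (\<lambda>n. \<integral>x. cos (t \<bullet> W n x) \<partial>M) \<longlonglongrightarrow> (\<integral>x. cos (t \<bullet> Z x) \<partial>N)"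
    and sin: "\<And>t. (\<lambda>n. \<integral>x. sin (t \<bullet> W n x) \<partial>M) \<longlonglongrightarrow> (\<integral>x. sin (t \<bullet> Z x) \<partial>N)"
    and "trig_poly p"
  shows "(\<forall>n. integrable M (\<lambda>x. p (W n x))) \<and> integrable N (\<lambda>x. p (Z x)) \<and>
    (\<lambda>n. \<integral>x. p (W n x) \<partial>M) \<longlonglongrightarrow> (\<integral>x. p (Z x) \<partial>N)"
proof -
  interpret M: prob_space M by fact
  interpret N: prob_space N by fact
  show ?thesis
    using \<open>trig_poly p\<close>
  proof (induction rule: trig_poly.induct)
    case (cos t)
    show ?case
      by (auto intro!: assms M.integrable_const_bound[where B = 1] N.integrable_const_bound[where B = 1])
  next
    case (sin t)
    show ?case
      by (auto intro!: assms M.integrable_const_bound[where B = 1] N.integrable_const_bound[where B = 1])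
  qed (auto intro!: tendsto_intros)
qed

lemma expectation_vmax_tendsto:
  fixes W :: "nat \<Rightarrow> 'a \<Rightarrow> real ^ 'k" and Z :: "'b \<Rightarrow> real ^ 'k"
  assumes "prob_space M" "prob_space N"
    and W [measurable]: "\<And>n. W n \<in> borel_measurable M" and Z [measurable]: "Z \<in> borel_measurable N"
    and cos: "\<And>t. (\<lambda>n. \<integral>x. cos (t \<bullet> W n x) \<partial>M) \<longlonglongrightarrow> (\<integral>x. cos (t \<bullet> Z x) \<partial>N)"
    and sin: "\<And>t. (\<lambda>n. \<integral>x. sin (t \<bullet> W n x) \<partial>M) \<longlonglongrightarrow> (\<integral>x. sin (t \<bullet> Z x) \<partial>N)"
    and W2: "\<And>n. integrable M (\<lambda>x. (norm (W n x))\<^sup>2)" "\<And>n. (\<integral>x. (norm (W n x))\<^sup>2 \<partial>M) \<le> v"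
    and Z2: "integrable N (\<lambda>x. (norm (Z x))\<^sup>2)" "(\<integral>x. (norm (Z x))\<^sup>2 \<partial>N) \<le> v"
  shows "(\<lambda>n. \<integral>x. vmax (W n x) \<partial>M) \<longlonglongrightarrow> (\<integral>x. vmax (Z x) \<partial>N)"
proof (rule LIMSEQ_I)
  fix r :: real assume "0 < r"
  \<comment> \<open>Each of the two approximations costs at most \<open>2 * e\<close> and the
    convergence for \<open>p\<close> less than \<open>e\<close>, so the total stays below
    \<open>5 * e < r\<close>.\<close>
  define e where "e = r / 6"
  have "0 < e" using \<open>0 < r\<close> by (simp add: e_def)
  have "0 \<le> v" using Z2(2) by (rule order_trans[rotated]) simp
  \<comment> \<open>Chosen such that \<open>2 * L * e = v + 1\<close>, whence
    \<open>v / (2 * L) \<le> e\<close>; the summand 1 keeps \<open>L\<close> positive when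
    \<open>v = 0\<close>.\<close>
  define L where "L = (v + 1) / (2 * e)"
  have "0 < L" using \<open>0 < e\<close> \<open>0 \<le> v\<close> by (simp add: L_def)
  have vL: "v / (2 * L) \<le> e"
  proof -
    have "2 * L * e = v + 1"
      using \<open>0 < e\<close> by (simp add: L_def)
    then show ?thesis
      using \<open>0 < L\<close> by (simp add: pos_divide_le_eq mult_ac)
  qed
  obtain p :: "real ^ 'k \<Rightarrow> real" where p: "trig_poly p"
    and pe: "\<And>x. \<bar>vmax x - p x\<bar> \<le> (norm x)\<^sup>2 / (2 * L) + e"
    using vmax_trig_poly_approx[OF \<open>0 < L\<close> \<open>0 < e\<close>] by blast
  note p_conv = expectation_trig_poly_tendsto[OF assms(1-6) p]
  \<comment> \<open>Stated for an arbitrary probability space, since it is applied both to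
    \<open>W n\<close> on \<open>M\<close> and to \<open>Z\<close> on \<open>N\<close>. The bound
    involves only \<open>v\<close>, hence is uniform in \<open>n\<close>.\<close>
  have close: "\<bar>(\<integral>x. vmax (U x) \<partial>Q) - (\<integral>x. p (U x) \<partial>Q)\<bar> \<le> 2 * e"
    if "prob_space Q" and [measurable]: "U \<in> borel_measurable Q"
      and U2: "integrable Q (\<lambda>x. (norm (U x))\<^sup>2)" "(\<integral>x. (norm (U x))\<^sup>2 \<partial>Q) \<le> v"
      and pU: "integrable Q (\<lambda>x. p (U x))"
    for Q :: "'c measure" and U :: "'c \<Rightarrow> real ^ 'k"
  proof -
    interpret Q: prob_space Q by fact
    have "integrable Q (\<lambda>x. norm (U x))"
      using U2(1) by (rule Q.square_integrable_imp_integrable[rotated]) simp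
    then have vU: "integrable Q (\<lambda>x. vmax (U x))"
      by (rule Bochner_Integration.integrable_bound) (use abs_vmax_le_norm in auto)
    have "\<bar>(\<integral>x. vmax (U x) \<partial>Q) - (\<integral>x. p (U x) \<partial>Q)\<bar> = \<bar>\<integral>x. vmax (U x) - p (U x) \<partial>Q\<bar>"
      using vU pU by simp
    also have "\<dots> \<le> (\<integral>x. \<bar>vmax (U x) - p (U x)\<bar> \<partial>Q)"
      by (rule integral_abs_bound)
    also have "\<dots> \<le> (\<integral>x. (norm (U x))\<^sup>2 / (2 * L) + e \<partial>Q)"
      using vU pU U2(1) pe by (intro integral_mono) auto
    also have "\<dots> = (\<integral>x. (norm (U x))\<^sup>2 \<partial>Q) / (2 * L) + e"
      using U2(1) by (simp add: Q.prob_space)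
    also have "\<dots> \<le> v / (2 * L) + e"
      using U2(2) \<open>0 < L\<close> by (simp add: divide_right_mono)
    finally show ?thesis using vL by simp
  qed
  obtain n0 where n0: "\<And>n. n \<ge> n0 \<Longrightarrow> \<bar>(\<integral>x. p (W n x) \<partial>M) - (\<integral>x. p (Z x) \<partial>N)\<bar> < e"
    using LIMSEQ_D[OF p_conv[THEN conjunct2, THEN conjunct2] \<open>0 < e\<close>] by auto
  have "norm ((\<integral>x. vmax (W n x) \<partial>M) - (\<integral>x. vmax (Z x) \<partial>N)) < r" if "n \<ge> n0" for n
  proof -
    have "\<bar>(\<integral>x. vmax (W n x) \<partial>M) - (\<integral>x. p (W n x) \<partial>M)\<bar> \<le> 2 * e"
      using p_conv by (intro close[OF assms(1) W W2]) simp
    moreover have "\<bar>(\<integral>x. vmax (Z x) \<partial>N) - (\<integral>x. p (Z x) \<partial>N)\<bar> \<le> 2 * e"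
      using p_conv by (intro close[OF assms(2) Z Z2]) simp
    ultimately show ?thesis
      using n0[OF that] \<open>0 < e\<close> unfolding e_def real_norm_def by linarith
  qed
  then show "\<exists>n0. \<forall>n\<ge>n0. norm ((\<integral>x. vmax (W n x) \<partial>M) - (\<integral>x. vmax (Z x) \<partial>N)) < r" by blast
qed

section \<open>The one-dimensional central limit theorem in terms of characteristic
  functions\<close>

lemma (in prob_space) char_scaled_sum_tendsto:
  fixes V :: "nat \<Rightarrow> 'a \<Rightarrow> real"
  assumes indep: "indep_vars (\<lambda>_. borel) V UNIV"
    and mean: "\<And>n. expectation (V n) = 0"
    and sq: "\<And>n. integrable M (\<lambda>x. (V n x)\<^sup>2)"
    and var: "\<And>n. expectation (\<lambda>x. (V n x)\<^sup>2) = s"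
    and ident: "\<And>n. distr M borel (V n) = \<mu>"
  shows "(\<lambda>n. CLINT x|M. iexp ((\<Sum>i<n. V i x) / sqrt (real n))) \<longlonglongrightarrow> char (normal_law 0 s) 1"
proof -
  have V [measurable]: "random_variable borel (V n)" for n
    using indep unfolding indep_vars_def2 by simp
  have "0 \<le> s" unfolding var[of 0, symmetric] by simp
  have normal: "char (normal_law 0 s) 1 = char std_normal_distribution (sqrt s)"
    unfolding normal_law_def char_def by (subst integral_distr) auto
  show ?thesis
  \<comment> \<open>For \<open>s = 0\<close> all summands vanish almost surely and the limit law is
    the point mass at 0, so both sides are 1. Only for \<open>s > 0\<close> can the sum be
    normalised to unit variance.\<close>
  proof (cases "s = 0")
    case True
    have "AE x in M. V n x = 0" for n
      using integral_nonneg_eq_0_iff_AE[OF sq[of n]] var[of n] True by auto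
    then have ae: "AE x in M. \<forall>n. V n x = 0" by (simp add: AE_all_countable)
    have "(CLINT x|M. iexp ((\<Sum>i<n. V i x) / sqrt (real n))) = (CLINT x|M. 1)" for n
      by (rule integral_cong_AE) (use ae in \<open>auto elim!: eventually_mono\<close>)
    moreover have "char std_normal_distribution 0 = 1"
      by (rule real_distribution.char_zero)
        (simp add: real_distribution_def real_distribution_axioms_def prob_space_normal_density)
    ultimately show ?thesis
      using normal by (simp add: True prob_space)
  next
    case False
    define \<sigma> where "\<sigma> = sqrt s"
    have \<sigma>: "0 < \<sigma>" "\<sigma>\<^sup>2 = s" using False \<open>0 \<le> s\<close> by (auto simp: \<sigma>_def)
    have "weak_conv_m (\<lambda>n. distr M borel (\<lambda>x. (\<Sum>i<n. V i x) / sqrt (n * \<sigma>\<^sup>2))) std_normal_distribution"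
      by (rule central_limit_theorem_zero_mean[where \<mu> = \<mu>]) (use assms \<sigma> in auto)
    then have "(\<lambda>n. char (distr M borel (\<lambda>x. (\<Sum>i<n. V i x) / sqrt (n * \<sigma>\<^sup>2))) \<sigma>)
        \<longlonglongrightarrow> char std_normal_distribution \<sigma>"
      by (intro levy_continuity1 real_distribution_distr)
        (auto simp: real_distribution_def real_distribution_axioms_def prob_space_normal_density)
    \<comment> \<open>The normalisation by \<open>sqrt (n * \<sigma>\<^sup>2)\<close> contains an
      extra factor \<open>\<sigma>\<close>, which evaluation at the argument \<open>\<sigma>\<close>
      cancels.\<close>
    moreover have "char (distr M borel (\<lambda>x. (\<Sum>i<n. V i x) / sqrt (n * \<sigma>\<^sup>2))) \<sigma>
        = (CLINT x|M. iexp ((\<Sum>i<n. V i x) / sqrt (real n)))" for n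
      unfolding char_def using \<sigma>(1)
      by (subst integral_distr) (auto simp: real_sqrt_mult)
    ultimately show ?thesis
      unfolding normal by (simp add: \<sigma>_def)
  qed
qed

subsection \<open>Sums of centred i.i.d. vectors\<close>

text \<open>Otherwise the simplifier turns \<open>Y 1\<close> into \<open>Y (Suc 0)\<close>, and \<open>distr_Y_Suc\<close> loops.\<close>

declare One_nat_def [simp del]

lemma norm_power2_eq_sum: "(norm y)\<^sup>2 = (\<Sum>k\<in>UNIV. (y $ k)\<^sup>2)" for y :: "real ^ 'k"
  unfolding power2_norm_eq_inner by (simp add: inner_vec_def power2_eq_square)

text \<open>Moments are required of \<open>Y 1\<close> only and reach every \<open>Y (Suc i)\<close>
  through the common law. The index \<open>Suc i\<close> matches sums starting at 1 with a central
  limit theorem indexed from 0.\<close>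

locale centred_iid = prob_space P
  for P :: "'a measure" +
  fixes Y :: "nat \<Rightarrow> 'a \<Rightarrow> real ^ 'k"
  assumes indep: "indep_vars (\<lambda>_. borel) Y {1..}"
    and ident: "\<And>i. i \<ge> 1 \<Longrightarrow> distr P borel (Y i) = distr P borel (Y 1)"
    and mean: "\<And>k. expectation (\<lambda>\<omega>. Y 1 \<omega> $ k) = 0"
    and square_integrable: "\<And>k. integrable P (\<lambda>\<omega>. (Y 1 \<omega> $ k)\<^sup>2)"
begin

abbreviation "S \<equiv> partial_sum Y"

abbreviation "C \<equiv> covariance_matrix P (Y 1)"

lemma Y_measurable: "i \<ge> 1 \<Longrightarrow> Y i \<in> borel_measurable P"
  using indep unfolding indep_vars_def2 by simp

lemma Y_Suc_measurable [measurable]: "Y (Suc i) \<in> borel_measurable P"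
  by (rule Y_measurable) simp

lemma Y_1_measurable [measurable]: "Y 1 \<in> borel_measurable P"
  by (rule Y_measurable) simp

lemma distr_Y_Suc: "distr P borel (Y (Suc i)) = distr P borel (Y 1)"
  by (rule ident) simp

lemma integrable_Y_Suc_iff:
  fixes g :: "real ^ 'k \<Rightarrow> real"
  assumes [measurable]: "g \<in> borel_measurable borel"
  shows "integrable P (\<lambda>\<omega>. g (Y (Suc i) \<omega>)) \<longleftrightarrow> integrable P (\<lambda>\<omega>. g (Y 1 \<omega>))"
  using integrable_distr_eq[of "Y (Suc i)" P borel g] integrable_distr_eq[of "Y 1" P borel g]
  unfolding distr_Y_Suc by simp

lemma expectation_Y_Suc:
  fixes g :: "real ^ 'k \<Rightarrow> real"
  assumes [measurable]: "g \<in> borel_measurable borel"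
  shows "expectation (\<lambda>\<omega>. g (Y (Suc i) \<omega>)) = expectation (\<lambda>\<omega>. g (Y 1 \<omega>))"
  using integral_distr[of "Y (Suc i)" P borel g] integral_distr[of "Y 1" P borel g]
  unfolding distr_Y_Suc by simp

lemma square_integrable_inner: "integrable P (\<lambda>\<omega>. (t \<bullet> Y (Suc i) \<omega>)\<^sup>2)"
proof -
  have cs: "(t \<bullet> y)\<^sup>2 \<le> (norm t)\<^sup>2 * (norm y)\<^sup>2" for y
    using Cauchy_Schwarz_ineq2[of t y] abs_le_square_iff[of "t \<bullet> y" "norm t * norm y"]
    by (simp add: power_mult_distrib)
  have "integrable P (\<lambda>\<omega>. (t \<bullet> Y 1 \<omega>)\<^sup>2)"
  proof (rule Bochner_Integration.integrable_bound)
    show "integrable P (\<lambda>\<omega>. (norm t)\<^sup>2 * (norm (Y 1 \<omega>))\<^sup>2)"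
      unfolding norm_power2_eq_sum
      by (intro integrable_mult_right Bochner_Integration.integrable_sum square_integrable)
    show "AE \<omega> in P. norm ((t \<bullet> Y 1 \<omega>)\<^sup>2) \<le> norm ((norm t)\<^sup>2 * (norm (Y 1 \<omega>))\<^sup>2)"
      using cs by simp
  qed measurable
  then show ?thesis by (subst integrable_Y_Suc_iff) auto
qed

lemma integrable_inner: "integrable P (\<lambda>\<omega>. t \<bullet> Y (Suc i) \<omega>)"
  by (rule square_integrable_imp_integrable[OF _ square_integrable_inner]) simp

lemma integrable_component: "integrable P (\<lambda>\<omega>. Y (Suc i) \<omega> $ k)"
  using integrable_inner[of "axis k 1" i] by (simp add: inner_axis')

lemma expectation_inner: "expectation (\<lambda>\<omega>. t \<bullet> Y (Suc i) \<omega>) = 0"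
proof -
  have "expectation (\<lambda>\<omega>. t \<bullet> Y 1 \<omega>) = (\<Sum>k\<in>UNIV. t $ k * expectation (\<lambda>\<omega>. Y 1 \<omega> $ k))"
    using integrable_component[of 0] by (simp add: One_nat_def inner_vec_def Bochner_Integration.integral_sum)
  then show ?thesis
    by (subst expectation_Y_Suc) (simp_all only: mean mult_zero_right sum.neutral_const borel_measurable_inner_const)
qed

text \<open>Matches the variance in the central limit theorem for \<open>t \<bullet> Y\<close> with
  the one that \<open>multivariate_normal\<close> prescribes for \<open>t \<bullet> Z\<close>.
  Expanding the square needs integrable products, which
  \<open>\<bar>a * b\<bar> \<le> a\<^sup>2 + b\<^sup>2\<close> provides.\<close>

lemma covariance_quadratic_form: "expectation (\<lambda>\<omega>. (t \<bullet> Y (Suc i) \<omega>)\<^sup>2) = t \<bullet> (C *v t)"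
proof -
  have prod: "integrable P (\<lambda>\<omega>. Y 1 \<omega> $ i * Y 1 \<omega> $ j)" for i j
  proof (rule Bochner_Integration.integrable_bound)
    show "integrable P (\<lambda>\<omega>. (Y 1 \<omega> $ i)\<^sup>2 + (Y 1 \<omega> $ j)\<^sup>2)"
      using square_integrable by auto
    have "\<bar>a * b\<bar> \<le> a\<^sup>2 + b\<^sup>2" for a b :: real
      using sum_squares_bound[of "\<bar>a\<bar>" "\<bar>b\<bar>"] mult_nonneg_nonneg[of "\<bar>a\<bar>" "\<bar>b\<bar>"]
      unfolding abs_mult power2_abs by linarith
    then show "AE \<omega> in P. norm (Y 1 \<omega> $ i * Y 1 \<omega> $ j) \<le> norm ((Y 1 \<omega> $ i)\<^sup>2 + (Y 1 \<omega> $ j)\<^sup>2)"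
      by simp
  qed measurable
  have C: "C $ i $ j = expectation (\<lambda>\<omega>. Y 1 \<omega> $ i * Y 1 \<omega> $ j)" for i j
    unfolding covariance_matrix_def mean by simp
  have sq: "(t \<bullet> y)\<^sup>2 = (\<Sum>i\<in>UNIV. \<Sum>j\<in>UNIV. t $ i * t $ j * (y $ i * y $ j))" for y
    by (simp add: inner_vec_def power2_eq_square sum_product mult_ac)
  have "expectation (\<lambda>\<omega>. (t \<bullet> Y 1 \<omega>)\<^sup>2) =
      (\<Sum>i\<in>UNIV. \<Sum>j\<in>UNIV. t $ i * t $ j * expectation (\<lambda>\<omega>. Y 1 \<omega> $ i * Y 1 \<omega> $ j))"
    unfolding sq using prod by (simp add: Bochner_Integration.integral_sum)
  also have "\<dots> = t \<bullet> (C *v t)"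
    by (simp add: inner_vec_def matrix_vector_mult_def C sum_distrib_left mult_ac)
  finally show ?thesis by (subst expectation_Y_Suc) auto
qed

lemma S_Suc: "S (Suc n) \<omega> = S n \<omega> + Y (Suc n) \<omega>"
  by (simp add: partial_sum_def)

lemma S_0: "S 0 \<omega> = 0"
  by (simp add: partial_sum_def)

lemma S_eq_sum_Suc: "S n \<omega> = (\<Sum>i<n. Y (Suc i) \<omega>)"
  by (simp add: partial_sum_def One_nat_def sum.atLeast1_atMost_eq)

lemma S_measurable [measurable]: "S n \<in> borel_measurable P"
  unfolding S_eq_sum_Suc[abs_def] by measurable

lemma integrable_S_component: "integrable P (\<lambda>\<omega>. S n \<omega> $ k)"
  unfolding S_eq_sum_Suc by (simp add: integrable_component)

text \<open>The two variables are functions of the disjoint blocks \<open>{1..n}\<close> and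
  \<open>{Suc n}\<close> of an independent family.\<close>

lemma indep_S_Y: "indep_var borel (S n) borel (Y (Suc n))"
proof -
  have "indep_var
      borel ((\<lambda>y. \<Sum>i\<in>{1..n}. y i) \<circ> (\<lambda>\<omega>. restrict (\<lambda>i. Y i \<omega>) {1..n}))
      borel ((\<lambda>y. y (Suc n)) \<circ> (\<lambda>\<omega>. restrict (\<lambda>i. Y i \<omega>) {Suc n}))"
    by (intro indep_var_compose[OF indep_var_restrict[OF indep]]) auto
  moreover have "(\<lambda>y. \<Sum>i\<in>{1..n}. y i) \<circ> (\<lambda>\<omega>. restrict (\<lambda>i. Y i \<omega>) {1..n}) = S n"
    by (auto simp: fun_eq_iff partial_sum_def)
  moreover have "(\<lambda>y. y (Suc n)) \<circ> (\<lambda>\<omega>. restrict (\<lambda>i. Y i \<omega>) {Suc n}) = Y (Suc n)"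
    by auto
  ultimately show ?thesis by simp
qed

text \<open>In the induction step the cross term has mean zero, by independence and centring. This
  yields the uniform second moment bound for \<open>S n / sqrt n\<close>.\<close>

lemma variance_S:
  "integrable P (\<lambda>\<omega>. (S n \<omega> $ k)\<^sup>2) \<and>
    expectation (\<lambda>\<omega>. (S n \<omega> $ k)\<^sup>2) = real n * expectation (\<lambda>\<omega>. (Y 1 \<omega> $ k)\<^sup>2)"
proof (induction n)
  case 0
  show ?case by (simp add: S_0)
next
  case (Suc n)
  have ind: "indep_var borel (\<lambda>\<omega>. S n \<omega> $ k) borel (\<lambda>\<omega>. Y (Suc n) \<omega> $ k)"
    using indep_var_compose[OF indep_S_Y[of n], of "\<lambda>y. y $ k" borel "\<lambda>y. y $ k" borel]
    by (simp add: comp_def)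
  have prod: "integrable P (\<lambda>\<omega>. S n \<omega> $ k * Y (Suc n) \<omega> $ k)"
    by (rule indep_var_integrable[OF ind integrable_S_component integrable_component])
  have "expectation (\<lambda>\<omega>. Y (Suc n) \<omega> $ k) = 0"
    using expectation_inner[of "axis k 1" n] by (simp add: inner_axis')
  then have prod0: "expectation (\<lambda>\<omega>. S n \<omega> $ k * Y (Suc n) \<omega> $ k) = 0"
    using indep_var_lebesgue_integral[OF ind integrable_S_component integrable_component] by simp
  have Y2: "integrable P (\<lambda>\<omega>. (Y (Suc n) \<omega> $ k)\<^sup>2)"
    "expectation (\<lambda>\<omega>. (Y (Suc n) \<omega> $ k)\<^sup>2) = expectation (\<lambda>\<omega>. (Y 1 \<omega> $ k)\<^sup>2)"
    using square_integrable[of k] by (simp_all add: integrable_Y_Suc_iff[of "\<lambda>y. (y $ k)\<^sup>2"]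
        expectation_Y_Suc[of "\<lambda>y. (y $ k)\<^sup>2"])
  have "(S (Suc n) \<omega> $ k)\<^sup>2 =
      (S n \<omega> $ k)\<^sup>2 + (Y (Suc n) \<omega> $ k)\<^sup>2 + 2 * (S n \<omega> $ k * Y (Suc n) \<omega> $ k)" for \<omega>
    by (simp add: S_Suc power2_sum)
  with Suc Y2 prod prod0 show ?case
    by (simp add: distrib_right)
qed

lemma integrable_vmax_S: "integrable P (\<lambda>\<omega>. vmax (S n \<omega>))"
proof (rule Bochner_Integration.integrable_bound)
  show "integrable P (\<lambda>\<omega>. \<Sum>k\<in>UNIV. \<bar>S n \<omega> $ k\<bar>)"
    by (simp add: integrable_S_component)
  show "AE \<omega> in P. norm (vmax (S n \<omega>)) \<le> norm (\<Sum>k\<in>UNIV. \<bar>S n \<omega> $ k\<bar>)"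
    using abs_vmax_le_norm norm_le_l1_cart by (auto intro!: AE_I2 order_trans[OF abs_vmax_le_norm]
        order_trans[OF norm_le_l1_cart])
qed measurable

section \<open>Selection premiums as increments of the total bias\<close>

lemma total_bias_0: "total_bias P Y 0 = 0"
  by (simp add: total_bias_def S_0)

text \<open>By independence the pair \<open>(S n, Y (Suc n))\<close> has a product law. Fubini then
  identifies the mean of the inner integral at \<open>u = S n\<close> with the mean of
  \<open>vmax (S n + Y (Suc n))\<close>, that is, of \<open>vmax (S (Suc n))\<close>.\<close>

lemma expectation_selection_premium:
  "expectation (\<lambda>\<omega>. selection_premium (distr P borel (Y 1)) (S n \<omega>)) =
    total_bias P Y (Suc n) - total_bias P Y n"
proof -
  let ?DS = "distr P borel (S n)" and ?DY = "distr P borel (Y 1)"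
  interpret DS: prob_space ?DS by (rule prob_space_distr) simp
  interpret DY: prob_space ?DY by (rule prob_space_distr) simp
  interpret pair: pair_sigma_finite ?DS ?DY ..
  have joint: "?DS \<Otimes>\<^sub>M ?DY = distr P (borel \<Otimes>\<^sub>M borel) (\<lambda>\<omega>. (S n \<omega>, Y (Suc n) \<omega>))"
    using indep_S_Y[of n] unfolding indep_var_distribution_eq distr_Y_Suc by simp
  have v [measurable]: "(\<lambda>x. vmax (fst x + snd x)) \<in> borel_measurable ((borel \<Otimes>\<^sub>M borel) :: ((real ^ 'k) \<times> (real ^ 'k)) measure)"
    by measurable
  have int: "integrable (?DS \<Otimes>\<^sub>M ?DY) (\<lambda>x. vmax (fst x + snd x))"
    unfolding joint using integrable_vmax_S[of "Suc n"] by (subst integrable_distr_eq) (auto simp: S_Suc)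
  have int1: "integrable ?DS (\<lambda>u. \<integral>y. vmax (u + y) \<partial>?DY)"
    using pair.integrable_fst'[OF int] by simp
  have "(\<integral>u. \<integral>y. vmax (u + y) \<partial>?DY \<partial>?DS) = (\<integral>x. vmax (fst x + snd x) \<partial>(?DS \<Otimes>\<^sub>M ?DY))"
    using pair.integral_fst'[OF int] by simp
  also have "\<dots> = total_bias P Y (Suc n)"
    unfolding joint total_bias_def by (subst integral_distr) (auto simp: S_Suc)
  finally have fub: "(\<integral>u. \<integral>y. vmax (u + y) \<partial>?DY \<partial>?DS) = total_bias P Y (Suc n)" .
  \<comment> \<open>Measurability of the inner integral in \<open>u\<close> allows integrals over
    the law of \<open>S n\<close> to be pulled back to \<open>P\<close>.\<close>
  have meas: "(\<lambda>u. \<integral>y. vmax (u + y) \<partial>?DY) \<in> borel_measurable borel"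
    using borel_measurable_integrable[OF int1] by simp
  have "integrable P (\<lambda>\<omega>. \<integral>y. vmax (S n \<omega> + y) \<partial>?DY)"
    using int1 meas by (simp add: integrable_distr_eq)
  moreover have "expectation (\<lambda>\<omega>. \<integral>y. vmax (S n \<omega> + y) \<partial>?DY) = total_bias P Y (Suc n)"
    using fub meas by (simp add: integral_distr)
  ultimately show ?thesis
    unfolding selection_premium_def
    using integrable_vmax_S[of n] by (simp add: total_bias_def)
qed

text \<open>The sum telescopes down to the total bias at 0, which is zero; as \<open>i\<close>
  starts at 1, the truncated subtraction \<open>i - 1\<close> is a true one.\<close>

lemma sum_selection_premium:
  "(\<Sum>i=1..n. expectation (\<lambda>\<omega>. selection_premium (distr P borel (Y 1)) (S (i - 1) \<omega>))) =
    total_bias P Y n"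
  using sum_lessThan_telescope[of "total_bias P Y" n]
  by (simp add: sum.atLeast1_atMost_eq[folded One_nat_def] expectation_selection_premium total_bias_0)

section \<open>Characteristic functions of the scaled sums\<close>

lemma indep_inner: "indep_vars (\<lambda>_. borel) (\<lambda>i \<omega>. t \<bullet> Y (Suc i) \<omega>) UNIV"
proof -
  have "indep_vars (\<lambda>j. Pi\<^sub>M {Suc j} (\<lambda>_. borel)) (\<lambda>j \<omega>. restrict (\<lambda>i. Y i \<omega>) {Suc j}) UNIV"
    by (rule indep_vars_restrict[OF indep]) (auto simp: disjoint_family_on_def)
  then have "indep_vars (\<lambda>_. borel) (\<lambda>j \<omega>. t \<bullet> restrict (\<lambda>i. Y i \<omega>) {Suc j} (Suc j)) UNIV"
  proof (rule indep_vars_compose2)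
    fix j :: nat
    show "(\<lambda>y. t \<bullet> y (Suc j)) \<in> borel_measurable (Pi\<^sub>M {Suc j} (\<lambda>_. borel :: (real ^ 'k) measure))"
      by measurable
  qed
  then show ?thesis by simp
qed

text \<open>Cramer-Wold reduction: for fixed \<open>t\<close>, the inner product with
  \<open>S n\<close> is a sum of centred i.i.d. real variables of variance
  \<open>t \<bullet> (C *v t)\<close>.\<close>

lemma char_inner_S_tendsto:
  "(\<lambda>n. CLINT \<omega>|P. iexp (t \<bullet> ((1 / sqrt (real n)) *\<^sub>R S n \<omega>))) \<longlonglongrightarrow>
    char (normal_law 0 (t \<bullet> (C *v t))) 1"
proof -
  have "distr P borel (\<lambda>\<omega>. t \<bullet> Y (Suc n) \<omega>) = distr (distr P borel (Y 1)) borel (\<lambda>y. t \<bullet> y)" for n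
    unfolding distr_Y_Suc[of n, symmetric] by (subst distr_distr) (auto simp: comp_def)
  then have "(\<lambda>n. CLINT \<omega>|P. iexp ((\<Sum>i<n. t \<bullet> Y (Suc i) \<omega>) / sqrt (real n))) \<longlonglongrightarrow>
      char (normal_law 0 (t \<bullet> (C *v t))) 1"
    by (intro char_scaled_sum_tendsto indep_inner expectation_inner square_integrable_inner
        covariance_quadratic_form)
  moreover have "(\<Sum>i<n. t \<bullet> Y (Suc i) \<omega>) / sqrt (real n) = t \<bullet> ((1 / sqrt (real n)) *\<^sub>R S n \<omega>)" for n \<omega>
    by (simp add: S_eq_sum_Suc inner_sum_right)
  ultimately show ?thesis by simp
qed

end

section \<open>Moments of the multivariate normal law\<close>

context
  fixes N :: "'b measure" and Z :: "'b \<Rightarrow> real ^ 'k" and C :: "real ^ 'k ^ 'k"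
  assumes normal: "multivariate_normal N Z 0 C"
begin

lemma multivariate_normal_measurable [measurable]: "Z \<in> borel_measurable N"
  using normal by (simp add: multivariate_normal_def)

lemma distr_inner_multivariate_normal:
  "distr N borel (\<lambda>\<omega>. t \<bullet> Z \<omega>) = normal_law 0 (t \<bullet> (C *v t))"
  using normal by (simp add: multivariate_normal_def)

lemma multivariate_normal_char:
  "(CLINT \<omega>|N. iexp (t \<bullet> Z \<omega>)) = char (normal_law 0 (t \<bullet> (C *v t))) 1"
  unfolding distr_inner_multivariate_normal[symmetric] char_def
  by (subst integral_distr) auto

lemma multivariate_normal_mean:
  "integrable N (\<lambda>\<omega>. t \<bullet> Z \<omega>) \<and> (\<integral>\<omega>. t \<bullet> Z \<omega> \<partial>N) = 0"
proof -
  have "integrable std_normal_distribution (\<lambda>x. x) \<and> integral\<^sup>L std_normal_distribution (\<lambda>x. x) = 0"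
    using integrable_std_normal_moment[of 1] integral_std_normal_moment_odd[of 0]
    by (simp add: integrable_density integral_density)
  then have "integrable (normal_law 0 v) (\<lambda>x. x) \<and> integral\<^sup>L (normal_law 0 v) (\<lambda>x. x) = 0" for v
    unfolding normal_law_def by (simp add: integrable_distr_eq integral_distr)
  from this[of "t \<bullet> (C *v t)"] show ?thesis
    unfolding distr_inner_multivariate_normal[symmetric]
    by (simp add: integrable_distr_eq integral_distr)
qed

text \<open>The second moment of \<open>normal_law 0 v\<close> is \<open>(sqrt v)\<^sup>2\<close>,
  which equals \<open>v\<close> only for \<open>v \<ge> 0\<close>, as the real \<open>sqrt\<close>
  is an odd function on the whole line.\<close>

lemma multivariate_normal_second_moment:
  assumes "0 \<le> t \<bullet> (C *v t)"
  shows "integrable N (\<lambda>\<omega>. (t \<bullet> Z \<omega>)\<^sup>2) \<and> (\<integral>\<omega>. (t \<bullet> Z \<omega>)\<^sup>2 \<partial>N) = t \<bullet> (C *v t)"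
proof -
  have "integrable std_normal_distribution (\<lambda>x. x\<^sup>2) \<and> integral\<^sup>L std_normal_distribution (\<lambda>x. x\<^sup>2) = 1"
    using integrable_std_normal_moment[of 2] integral_std_normal_moment_even[of 1]
    by (simp add: integrable_density integral_density)
  then have "integrable (normal_law 0 v) (\<lambda>x. x\<^sup>2) \<and> integral\<^sup>L (normal_law 0 v) (\<lambda>x. x\<^sup>2) = v"
    if "0 \<le> v" for v
    using that unfolding normal_law_def
    by (simp add: integrable_distr_eq integral_distr power_mult_distrib)
  from this[OF assms] show ?thesis
    unfolding distr_inner_multivariate_normal[symmetric]
    by (simp add: integrable_distr_eq integral_distr)
qed

end

section \<open>Square-root growth of the total bias\<close>

context centred_iid
begin

lemma covariance_nonneg: "0 \<le> t \<bullet> (C *v t)"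
  unfolding covariance_quadratic_form[of t 0, symmetric] by simp

context
  fixes N :: "'b measure" and Z :: "'b \<Rightarrow> real ^ 'k"
  assumes N: "prob_space N" and Z: "multivariate_normal N Z 0 C"
begin

interpretation N: prob_space N by (rule N)

lemmas Z_measurable [measurable] = multivariate_normal_measurable[OF Z]

lemmas Z_second_moment = multivariate_normal_second_moment[OF Z covariance_nonneg]

lemma Z_component:
  "integrable N (\<lambda>\<omega>. (Z \<omega> $ k)\<^sup>2)"
  "(\<integral>\<omega>. (Z \<omega> $ k)\<^sup>2 \<partial>N) = expectation (\<lambda>\<omega>. (Y 1 \<omega> $ k)\<^sup>2)"
  "integrable N (\<lambda>\<omega>. Z \<omega> $ k)"
  "(\<integral>\<omega>. Z \<omega> $ k \<partial>N) = 0"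
  using Z_second_moment[of "axis k 1"] multivariate_normal_mean[OF Z, of "axis k 1"]
    covariance_quadratic_form[of "axis k 1" 0, folded One_nat_def]
  by (simp_all add: inner_axis')

lemma integrable_vmax_Z: "integrable N (\<lambda>\<omega>. vmax (Z \<omega>))"
proof (rule Bochner_Integration.integrable_bound)
  show "integrable N (\<lambda>\<omega>. \<Sum>k\<in>UNIV. \<bar>Z \<omega> $ k\<bar>)"
    by (simp add: Z_component)
  show "AE \<omega> in N. norm (vmax (Z \<omega>)) \<le> norm (\<Sum>k\<in>UNIV. \<bar>Z \<omega> $ k\<bar>)"
    by (auto intro!: AE_I2 order_trans[OF abs_vmax_le_norm] order_trans[OF norm_le_l1_cart])
qed measurable

lemma total_bias_div_sqrt_tendsto:
  "(\<lambda>n. total_bias P Y n / sqrt (real n)) \<longlonglongrightarrow> (\<integral>\<omega>. vmax (Z \<omega>) \<partial>N)"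
proof -
  let ?W = "\<lambda>n \<omega>. (1 / sqrt (real n)) *\<^sub>R S n \<omega>"
  let ?v = "\<Sum>k\<in>UNIV. expectation (\<lambda>\<omega>. (Y 1 \<omega> $ k)\<^sup>2)"
  have int: "integrable P (\<lambda>\<omega>. iexp (t \<bullet> ?W n \<omega>))" "integrable N (\<lambda>\<omega>. iexp (t \<bullet> Z \<omega>))" for t n
    by (auto intro!: integrable_const_bound[where B = 1] N.integrable_const_bound[where B = 1])
  have char: "(\<lambda>n. CLINT \<omega>|P. iexp (t \<bullet> ?W n \<omega>)) \<longlonglongrightarrow> (CLINT \<omega>|N. iexp (t \<bullet> Z \<omega>))" for t
    unfolding multivariate_normal_char[OF Z] by (rule char_inner_S_tendsto)
  have cos: "(\<lambda>n. \<integral>\<omega>. cos (t \<bullet> ?W n \<omega>) \<partial>P) \<longlonglongrightarrow> (\<integral>\<omega>. cos (t \<bullet> Z \<omega>) \<partial>N)" for t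
    using tendsto_Re[OF char[of t]] unfolding integral_Re[OF int(1), symmetric] integral_Re[OF int(2), symmetric]
    by (simp only: Re_exp) simp
  have sin: "(\<lambda>n. \<integral>\<omega>. sin (t \<bullet> ?W n \<omega>) \<partial>P) \<longlonglongrightarrow> (\<integral>\<omega>. sin (t \<bullet> Z \<omega>) \<partial>N)" for t
    using tendsto_Im[OF char[of t]] unfolding integral_Im[OF int(1), symmetric] integral_Im[OF int(2), symmetric]
    by (simp only: Im_exp) simp
  have W2: "integrable P (\<lambda>\<omega>. (norm (?W n \<omega>))\<^sup>2)" "expectation (\<lambda>\<omega>. (norm (?W n \<omega>))\<^sup>2) \<le> ?v" for n
  proof -
    have eq: "(norm (?W n \<omega>))\<^sup>2 = (\<Sum>k\<in>UNIV. (S n \<omega> $ k)\<^sup>2 / real n)" for \<omega>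
      by (simp add: norm_power2_eq_sum power_divide sum_divide_distrib)
    show "integrable P (\<lambda>\<omega>. (norm (?W n \<omega>))\<^sup>2)"
      unfolding eq using variance_S by simp
    have "expectation (\<lambda>\<omega>. (norm (?W n \<omega>))\<^sup>2) =
        (\<Sum>k\<in>UNIV. real n * expectation (\<lambda>\<omega>. (Y 1 \<omega> $ k)\<^sup>2) / real n)"
      unfolding eq using variance_S by (simp add: Bochner_Integration.integral_sum)
    \<comment> \<open>Equality holds for \<open>n > 0\<close>; at \<open>n = 0\<close> division by
      zero makes the left side 0.\<close>
    also have "\<dots> \<le> ?v"
      by (intro sum_mono) (simp add: field_simps)
    finally show "expectation (\<lambda>\<omega>. (norm (?W n \<omega>))\<^sup>2) \<le> ?v" .
  qed
  have "(\<lambda>n. \<integral>\<omega>. vmax (?W n \<omega>) \<partial>P) \<longlonglongrightarrow> (\<integral>\<omega>. vmax (Z \<omega>) \<partial>N)"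
  proof (rule expectation_vmax_tendsto[OF prob_space_axioms N _ _ cos sin W2])
    show "integrable N (\<lambda>\<omega>. (norm (Z \<omega>))\<^sup>2)" "(\<integral>\<omega>. (norm (Z \<omega>))\<^sup>2 \<partial>N) \<le> ?v"
      unfolding norm_power2_eq_sum using Z_component
      by (simp_all add: Bochner_Integration.integral_sum)
  qed measurable
  then show ?thesis
    by (simp add: vmax_scaleR total_bias_def)
qed

text \<open>If \<open>E[max\<^sub>k Z\<^sub>k] = 0\<close>, then each \<open>Z\<^sub>k\<close> attains the maximum almost surely, so the variance of
  \<open>Z\<^sub>j - Z\<^sub>k\<close>, which is also the variance of \<open>Y\<^sub>j - Y\<^sub>k\<close>, vanishes.\<close>

lemma total_bias_eq_0:
  assumes "(\<integral>\<omega>. vmax (Z \<omega>) \<partial>N) = 0"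
  shows "total_bias P Y n = 0"
proof -
  have Zk: "AE \<omega> in N. vmax (Z \<omega>) = Z \<omega> $ k" for k
  proof -
    have "integrable N (\<lambda>\<omega>. vmax (Z \<omega>) - Z \<omega> $ k)" "(\<integral>\<omega>. vmax (Z \<omega>) - Z \<omega> $ k \<partial>N) = 0"
      using assms by (simp_all add: integrable_vmax_Z Z_component)
    then show ?thesis
      by (subst (asm) integral_nonneg_eq_0_iff_AE) (auto simp: component_le_vmax)
  qed
  \<comment> \<open>A reference coordinate: all coordinates of the increments, hence of
    \<open>S n\<close>, agree with the one at \<open>j\<close> almost surely, so the maximum has the
    mean of a single centred coordinate.\<close>
  fix j :: 'k
  have Yjk: "AE \<omega> in P. Y (Suc i) \<omega> $ k = Y (Suc i) \<omega> $ j" for i k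
  proof -
    let ?t = "axis k 1 - axis j 1 :: real ^ 'k"
    have t: "?t \<bullet> y = y $ k - y $ j" for y :: "real ^ 'k"
      by (simp add: inner_diff_left inner_axis')
    have "(\<integral>\<omega>. (?t \<bullet> Z \<omega>)\<^sup>2 \<partial>N) = (\<integral>\<omega>. 0 \<partial>N)"
    proof (rule integral_cong_AE)
      show "AE \<omega> in N. (?t \<bullet> Z \<omega>)\<^sup>2 = 0"
        using Zk[of k] Zk[of j] by eventually_elim (simp add: t)
    qed measurable
    then have "expectation (\<lambda>\<omega>. (?t \<bullet> Y (Suc i) \<omega>)\<^sup>2) = 0"
      using Z_second_moment[of ?t] covariance_quadratic_form[of ?t i] by simp
    then have "AE \<omega> in P. (?t \<bullet> Y (Suc i) \<omega>)\<^sup>2 = 0"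
      using square_integrable_inner by (subst (asm) integral_nonneg_eq_0_iff_AE) auto
    then show ?thesis by (simp add: t)
  qed
  then have "AE \<omega> in P. \<forall>i k. Y (Suc i) \<omega> $ k = Y (Suc i) \<omega> $ j"
    by (simp add: AE_all_countable)
  then have "AE \<omega> in P. vmax (S n \<omega>) = S n \<omega> $ j"
  proof eventually_elim
    fix \<omega>
    assume "\<forall>i k. Y (Suc i) \<omega> $ k = Y (Suc i) \<omega> $ j"
    then have "S n \<omega> $ k = S n \<omega> $ j" for k
      by (auto simp: S_eq_sum_Suc intro!: sum.cong)
    then show "vmax (S n \<omega>) = S n \<omega> $ j"
      by (intro order_antisym component_le_vmax) (metis order_refl vmax_le_iff)
  qed
  then have "total_bias P Y n = expectation (\<lambda>\<omega>. S n \<omega> $ j)"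
    unfolding total_bias_def by (intro integral_cong_AE) auto
  also have "\<dots> = (\<Sum>i<n. expectation (\<lambda>\<omega>. axis j 1 \<bullet> Y (Suc i) \<omega>))"
    by (simp add: S_eq_sum_Suc integrable_component inner_axis')
  finally show ?thesis by (simp only: expectation_inner sum.neutral_const)
qed

section \<open>The error term and the concentration ratio\<close>

lemma total_bias_smallo:
  "(\<lambda>n. total_bias P Y n - (\<integral>\<omega>. vmax (Z \<omega>) \<partial>N) * sqrt (real n)) \<in> o(\<lambda>n. sqrt (real n))"
proof (rule smalloI_tendsto)
  let ?c = "\<integral>\<omega>. vmax (Z \<omega>) \<partial>N"
  have "(\<lambda>n. total_bias P Y n / sqrt (real n) - ?c) \<longlonglongrightarrow> 0"
    using tendsto_diff[OF total_bias_div_sqrt_tendsto tendsto_const[of ?c]] by simp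
  then show "(\<lambda>n. (total_bias P Y n - ?c * sqrt (real n)) / sqrt (real n)) \<longlonglongrightarrow> 0"
    by (rule Lim_transform_eventually)
      (rule eventually_mono[OF eventually_gt_at_top[of "0::nat"]], simp add: diff_divide_distrib)
  show "\<forall>\<^sub>F n in sequentially. sqrt (real n) \<noteq> 0"
    using eventually_gt_at_top[of "0::nat"] by eventually_elim simp
qed

text \<open>With \<open>b n = total_bias P Y n / sqrt n\<close> and
  \<open>m = nat \<lfloor>\<alpha> * n\<rfloor>\<close>, the ratio is
  \<open>b m * sqrt (m / n) / b n\<close>. Both \<open>b m\<close> and \<open>b n\<close> tend to
  the same nonzero constant and \<open>m / n\<close> tends to \<alpha>.\<close>

lemma total_bias_ratio_tendsto:
  assumes nz: "\<forall>\<^sub>F n in sequentially. total_bias P Y n \<noteq> 0" and "0 < \<alpha>"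
  shows "(\<lambda>n. total_bias P Y (nat \<lfloor>\<alpha> * real n\<rfloor>) / total_bias P Y n) \<longlonglongrightarrow> sqrt \<alpha>"
proof -
  let ?c = "\<integral>\<omega>. vmax (Z \<omega>) \<partial>N" and ?m = "\<lambda>n. nat \<lfloor>\<alpha> * real n\<rfloor>"
  let ?b = "\<lambda>n. total_bias P Y n / sqrt (real n)"
  \<comment> \<open>If the constant were 0, the total bias would vanish for every \<open>n\<close>,
    against \<open>nz\<close>.\<close>
  have "?c \<noteq> 0"
    using total_bias_eq_0 eventually_happens'[OF sequentially_bot nz] by blast
  have m_top: "filterlim ?m sequentially sequentially"
    using \<open>0 < \<alpha>\<close> by real_asymp
  have eq: "?b m * sqrt (real m / real n) / ?b n = total_bias P Y m / total_bias P Y n"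
    if "0 < m" "0 < n" for m n
    using that by (simp add: real_sqrt_divide)
  have "(\<lambda>n. real (?m n) / real n) \<longlonglongrightarrow> \<alpha>"
    using \<open>0 < \<alpha>\<close> by real_asymp
  then have "(\<lambda>n. ?b (?m n) * sqrt (real (?m n) / real n) / ?b n) \<longlonglongrightarrow> ?c * sqrt \<alpha> / ?c"
    using \<open>?c \<noteq> 0\<close>
    by (intro tendsto_intros total_bias_div_sqrt_tendsto
        filterlim_compose[OF total_bias_div_sqrt_tendsto m_top])
  then have "(\<lambda>n. ?b (?m n) * sqrt (real (?m n) / real n) / ?b n) \<longlonglongrightarrow> sqrt \<alpha>"
    using \<open>?c \<noteq> 0\<close> by simp
  moreover have "\<forall>\<^sub>F n in sequentially. ?b (?m n) * sqrt (real (?m n) / real n) / ?b n =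
      total_bias P Y (?m n) / total_bias P Y n"
    using eventually_gt_at_top[of "0::nat"]
      eventually_compose_filterlim[OF eventually_gt_at_top[of "0::nat"] m_top]
    by eventually_elim (rule eq)
  ultimately show ?thesis
    by (rule Lim_transform_eventually)
qed

end

end

text \<open>The guard in the second part makes the quotient meaningful: it fails exactly when
  \<open>c = 0\<close>, where the total bias is identically zero and, with \<open>x / 0 = 0\<close>,
  the quotient would be constantly 0.\<close>

theorem theorem5p4:
  fixes P :: "'a measure" and MX :: "'x measure"
    and X :: "nat \<Rightarrow> 'a \<Rightarrow> 'x"
    and f :: "'k::finite \<Rightarrow> 'x \<Rightarrow> real"
    and Y :: "nat \<Rightarrow> 'a \<Rightarrow> real ^ 'k"
    and N :: "'b measure" and Z :: "'b \<Rightarrow> real ^ 'k" and c :: real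
  assumes P: "prob_space P"
    and X_indep: "prob_space.indep_vars P (\<lambda>_. MX) X {1..}"
    and X_ident: "\<And>i. i \<ge> 1 \<Longrightarrow> distr P MX (X i) = distr P MX (X 1)"
    and f_meas: "\<And>k. f k \<in> borel_measurable MX"
    and Y: "Y = centred_score P X f"
    and A1_indep: "prob_space.indep_vars P (\<lambda>_. borel) Y {1..}"
    and A1_ident: "\<And>i. i \<ge> 1 \<Longrightarrow> distr P borel (Y i) = distr P borel (Y 1)"
    and A1_past: "\<And>i. i \<ge> 1 \<Longrightarrow>
      prob_space.indep_set P {Y i -` B \<inter> space P | B. B \<in> sets borel} (past_events P MX X (i - 1))"
    and A2: "(\<integral>\<omega>. Y 1 \<omega> \<partial>P) = 0"
    and A3: "integrable P (\<lambda>\<omega>. MAX k. \<bar>Y 1 \<omega> $ k\<bar>)"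
    and var_finite: "\<And>k. integrable P (\<lambda>\<omega>. (Y 1 \<omega> $ k - (\<integral>\<omega>'. Y 1 \<omega>' $ k \<partial>P))\<^sup>2)"
    and N: "prob_space N"
    and Z: "multivariate_normal N Z 0 (covariance_matrix P (Y 1))"
    and c: "c = (\<integral>\<omega>. vmax (Z \<omega>) \<partial>N)"
  shows "((\<lambda>n. total_bias P Y n - c * sqrt (real n)) \<in> o(\<lambda>n. sqrt (real n))) \<and>
    ((\<forall>\<^sub>F n in sequentially. total_bias P Y n \<noteq> 0) \<longrightarrow>
      (\<forall>\<alpha>::real. 0 < \<alpha> \<and> \<alpha> < 1 \<longrightarrow>
        (\<lambda>n. (\<Sum>i=1..nat \<lfloor>\<alpha> * real n\<rfloor>.
                \<integral>\<omega>. selection_premium (distr P borel (Y 1)) (partial_sum Y (i - 1) \<omega>) \<partial>P)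
             / total_bias P Y n) \<longlonglongrightarrow> sqrt \<alpha>))"
proof -
  interpret P: prob_space P by (rule P)
  have Ym [measurable]: "Y 1 \<in> borel_measurable P"
    using A1_indep unfolding P.indep_vars_def2 by simp
  have int: "integrable P (\<lambda>\<omega>. Y 1 \<omega> $ k)" for k
    using A3
  proof (rule Bochner_Integration.integrable_bound)
    show "AE \<omega> in P. norm (Y 1 \<omega> $ k) \<le> norm (MAX k. \<bar>Y 1 \<omega> $ k\<bar>)"
      unfolding real_norm_def by (intro AE_I2 order_trans[OF _ abs_ge_self] Max_ge) auto
  qed measurable
  \<comment> \<open>The integral of a non-integrable function is 0 by convention, so integrability
    is what lets \<open>A2\<close> be read coordinatewise as centring.\<close>
  have intY: "integrable P (Y 1)"
  proof (rule Bochner_Integration.integrable_bound)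
    show "integrable P (\<lambda>\<omega>. \<Sum>k\<in>UNIV. \<bar>Y 1 \<omega> $ k\<bar>)"
      using int by simp
    show "AE \<omega> in P. norm (Y 1 \<omega>) \<le> norm (\<Sum>k\<in>UNIV. \<bar>Y 1 \<omega> $ k\<bar>)"
      by (auto intro!: AE_I2 order_trans[OF norm_le_l1_cart])
  qed measurable
  have mean: "(\<integral>\<omega>. Y 1 \<omega> $ k \<partial>P) = 0" for k
    using integral_bounded_linear[OF bounded_linear_vec_nth intY, of k] A2 by simp
  have sq: "integrable P (\<lambda>\<omega>. (Y 1 \<omega> $ k)\<^sup>2)" for k
    using var_finite[of k] by (simp only: mean diff_0_right)
  interpret centred_iid P Y
    by (intro centred_iid.intro centred_iid_axioms.intro P A1_indep A1_ident mean sq)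
  show ?thesis
    using total_bias_smallo[OF N Z] total_bias_ratio_tendsto[OF N Z]
    unfolding sum_selection_premium c by blast
qed

end
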